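(* Let $\phi$ be a \textsc{3Sat} instance with variables $x_1,\dots,x_N$ and clauses $C_1,\dots,C_M$, in which every clause involves exactly $3$ distinct variables and every variable appears in exactly $d$ clauses, where $d$ is a constant. Let $G_\phi$ be its clause/variable game and $G_\phi^{k\times\ell}$ its birthday repetition. Then there is a constant $C$ (depending only on $d$) such that for all $k\in[M]$ and $\ell\in[N]$, $$\omega(G_\phi)\ \ge\ \omega(G_\phi^{k\times\ell})-C\sqrt{\frac{N}{k\ell}}.$$
   Context: A two-prover game $G=(X,Y,A,B,\mathcal{D},V)$ has finite question sets $X,Y$, answer sets $A,B$, a distribution $\mathcal{D}$ on $X\times Y$, and $V:X\times Y\times A\times B\to[0,1]$; its value is $\omega(G)=\max_{a:X\to A,b:Y\to B}\mathbb{E}_{(x,y)\sim\mathcal{D}}[V(x,y,a(x),b(y))]$. The clause/variable game $G_\phi$: the verifier picks $i\in[M]$ uniformly, then $j\in[N]$ uniformly among the indices of variables occurring in $C_i$; he sends $i$ to prover 1 and $j$ to prover 2; prover 1 answers an assignment to the three variables of $C_i$, prover 2 answers a bit for $x_j$; the verifier accepts ($V=1$) iff prover 1's assignment satisfies $C_i$ and agrees with prover 2's bit on $x_j$. Thus $\mathcal{D}$ is uniform on a subset $Z\subseteq[M]\times[N]$ (the pairs with $x_j$ occurring in $C_i$), with $\{0,1\}$-valued $V$. Birthday repetition: for a game with $\{0,1\}$-valued $V$ and $\mathcal{D}$ uniform on $Z\subseteq X\times Y$, and integers $k\le|X|$, $\ell\le|Y|$, the free game $G^{k\times\ell}$ has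 the verifier choose uniformly random $S\subseteq X$ with $|S|=k$ and $T\subseteq Y$ with $|T|=\ell$ (independently), send $S$ to prover 1 (who answers $a:S\to A$) and $T$ to prover 2 (who answers $b:T\to B$), and accept iff $V(x,y,a(x),b(y))=1$ for all $(x,y)\in(S\times T)\cap Z$ (so he always accepts if this intersection is empty). Its value is the maximum acceptance probability over prover strategies (functions from question sets to answers). *)

theory Defs
  imports "HOL-Probability.Probability"
begin

record ('x, 'y, 'a, 'b) game =
  questions1 :: "'x set"
  questions2 :: "'y set"
  answers1 :: "'a set"
  answers2 :: "'b set"
  question_dist :: "('x \<times> 'y) pmf"
  verifier :: "'x \<Rightarrow> 'y \<Rightarrow> 'a \<Rightarrow> 'b \<Rightarrow> real"

definition two_prover_game :: "('x, 'y, 'a, 'b) game \<Rightarrow> bool" where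
  "two_prover_game G \<longleftrightarrow>
     finite (questions1 G) \<and> finite (questions2 G) \<and>
     finite (answers1 G) \<and> answers1 G \<noteq> {} \<and>
     finite (answers2 G) \<and> answers2 G \<noteq> {} \<and>
     set_pmf (question_dist G) \<subseteq> questions1 G \<times> questions2 G \<and>
     (\<forall>x\<in>questions1 G. \<forall>y\<in>questions2 G. \<forall>a\<in>answers1 G. \<forall>b\<in>answers2 G.
        verifier G x y a b \<in> {0..1})"

definition success_prob :: "('x, 'y, 'a, 'b) game \<Rightarrow> ('x \<Rightarrow> 'a) \<Rightarrow> ('y \<Rightarrow> 'b) \<Rightarrow> real" where
  "success_prob G a b =
     measure_pmf.expectation (question_dist G) (\<lambda>(x, y). verifier G x y (a x) (b y))"

definition game_value :: "('x, 'y, 'a, 'b) game \<Rightarrow> real" where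
  "game_value G =
     Max {success_prob G a b | a b.
            a \<in> questions1 G \<rightarrow>\<^sub>E answers1 G \<and> b \<in> questions2 G \<rightarrow>\<^sub>E answers2 G}"

text \<open>
  The construction is meant for games whose question distribution is uniform on a set \<open>Z\<close>;
  then \<open>Z\<close> is the support of that distribution.  An answer to \<open>S\<close> is a function \<open>S \<rightarrow> A\<close>.
  As a game has one answer set for all questions, the answer set is the union of these
  function spaces over all \<open>S\<close>, and a function with the wrong domain is rejected.
\<close>

definition k_subsets :: "'x set \<Rightarrow> nat \<Rightarrow> 'x set set" where
  "k_subsets X k = {S. S \<subseteq> X \<and> card S = k}"

definition birthday_repetition ::
  "('x, 'y, 'a, 'b) game \<Rightarrow> nat \<Rightarrow> nat \<Rightarrow> ('x set, 'y set, 'x \<Rightarrow> 'a, 'y \<Rightarrow> 'b) game" where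
  "birthday_repetition G k l =
     \<lparr> questions1 = k_subsets (questions1 G) k,
       questions2 = k_subsets (questions2 G) l,
       answers1 = (\<Union>S\<in>k_subsets (questions1 G) k. S \<rightarrow>\<^sub>E answers1 G),
       answers2 = (\<Union>T\<in>k_subsets (questions2 G) l. T \<rightarrow>\<^sub>E answers2 G),
       question_dist = pair_pmf (pmf_of_set (k_subsets (questions1 G) k))
                                (pmf_of_set (k_subsets (questions2 G) l)),
       verifier = (\<lambda>S T a b. of_bool
         (a \<in> S \<rightarrow>\<^sub>E answers1 G \<and> b \<in> T \<rightarrow>\<^sub>E answers2 G \<and>
          (\<forall>(x, y) \<in> (S \<times> T) \<inter> set_pmf (question_dist G). verifier G x y (a x) (b y) = 1))) \<rparr>"

text \<open>
  Variables are \<open>0, \<dots>, N - 1\<close>.  The literal \<open>(j, s)\<close> is true iff variable \<open>j\<close> has value \<open>s\<close>;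
  a clause is the disjunction of its literals.  Clauses of an instance are distinguished by
  their position in the list, so the same clause may occur several times.
\<close>

type_synonym clause = "(nat \<times> bool) set"

definition clause_vars :: "clause \<Rightarrow> nat set" where
  "clause_vars c = fst ` c"

definition satisfies :: "(nat \<rightharpoonup> bool) \<Rightarrow> clause \<Rightarrow> bool" where
  "satisfies a c \<longleftrightarrow> (\<exists>(j, s)\<in>c. a j = Some s)"

definition regular_3sat :: "nat \<Rightarrow> nat \<Rightarrow> clause list \<Rightarrow> bool" where
  "regular_3sat d N \<phi> \<longleftrightarrow>
     (\<forall>c\<in>set \<phi>. card c = 3 \<and> card (clause_vars c) = 3 \<and> clause_vars c \<subseteq> {..<N}) \<and>
     (\<forall>j<N. card {i. i < length \<phi> \<and> j \<in> clause_vars (\<phi> ! i)} = d)"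

text \<open>
  An answer of prover 1 to clause \<open>i\<close> is a partial map with domain the variables of that clause;
  assignments to the variables of other clauses are rejected.
\<close>

definition clause_variable_game ::
  "nat \<Rightarrow> clause list \<Rightarrow> (nat, nat, nat \<rightharpoonup> bool, bool) game" where
  "clause_variable_game N \<phi> =
     \<lparr> questions1 = {..<length \<phi>},
       questions2 = {..<N},
       answers1 = {a. \<exists>i<length \<phi>. dom a = clause_vars (\<phi> ! i)},
       answers2 = UNIV,
       question_dist = do {
         i \<leftarrow> pmf_of_set {..<length \<phi>};
         j \<leftarrow> pmf_of_set (clause_vars (\<phi> ! i));
         return_pmf (i, j)
       },
       verifier = (\<lambda>i j a b. of_bool
         (dom a = clause_vars (\<phi> ! i) \<and> satisfies a (\<phi> ! i) \<and> a j = Some b)) \<rparr>"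

lemma set_pmf_clause_variable_game:
  assumes "regular_3sat d N \<phi>" "\<phi> \<noteq> []"
  shows "set_pmf (question_dist (clause_variable_game N \<phi>)) =
           {(i, j). i < length \<phi> \<and> j \<in> clause_vars (\<phi> ! i)}"
proof -
  have "finite (clause_vars (\<phi> ! i)) \<and> clause_vars (\<phi> ! i) \<noteq> {}" if "i < length \<phi>" for i
    using assms that unfolding regular_3sat_def
    by (metis card.empty card.infinite nth_mem zero_neq_numeral)
  moreover have "{..<length \<phi>} \<noteq> {}" using assms by auto
  ultimately show ?thesis
    by (auto simp: clause_variable_game_def set_bind_pmf set_pmf_of_set)
qed

lemma question_dist_clause_variable_game:
  assumes "regular_3sat d N \<phi>" "\<phi> \<noteq> []"
  shows "question_dist (clause_variable_game N \<phi>) =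
           pmf_of_set {(i, j). i < length \<phi> \<and> j \<in> clause_vars (\<phi> ! i)}"
proof -
  let ?Z = "Sigma {..<length \<phi>} (\<lambda>i. clause_vars (\<phi> ! i))"
  have c: "card (clause_vars (\<phi> ! i)) = 3" if "i < length \<phi>" for i
    using assms that by (auto simp: regular_3sat_def)
  have f: "finite (clause_vars (\<phi> ! i))" "clause_vars (\<phi> ! i) \<noteq> {}" if "i < length \<phi>" for i
    using c[OF that] by (auto intro: card_ge_0_finite)
  have ne: "{..<length \<phi>} \<noteq> {}" using assms by auto
  have fz: "finite ?Z" using f by auto
  have nz: "?Z \<noteq> {}" using f ne by (auto simp: Sigma_empty_iff)
  have "card ?Z = 3 * length \<phi>"
    using f c by (subst card_SigmaI) auto
  hence "question_dist (clause_variable_game N \<phi>) = pmf_of_set ?Z"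
  proof (intro pmf_eqI)
    fix p :: "nat \<times> nat"
    assume cz: "card ?Z = 3 * length \<phi>"
    obtain i j where p: "p = (i, j)" by (cases p)
    have "pmf (question_dist (clause_variable_game N \<phi>)) (i, j) =
      (\<Sum>i'<length \<phi>. pmf (map_pmf (Pair i') (pmf_of_set (clause_vars (\<phi> ! i')))) (i, j))
        / length \<phi>"
      using ne by (simp add: clause_variable_game_def pmf_bind_pmf_of_set map_pmf_def)
    also have "(\<Sum>i'<length \<phi>. pmf (map_pmf (Pair i') (pmf_of_set (clause_vars (\<phi> ! i')))) (i, j)) =
      (\<Sum>i'<length \<phi>. if i' = i then pmf (pmf_of_set (clause_vars (\<phi> ! i))) j else 0)"
    proof (rule sum.cong)
      fix i'
      show "pmf (map_pmf (Pair i') (pmf_of_set (clause_vars (\<phi> ! i')))) (i, j) =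
        (if i' = i then pmf (pmf_of_set (clause_vars (\<phi> ! i))) j else 0)"
        by (cases "i' = i") (auto simp: pmf_map_inj' inj_on_def pmf_eq_0_set_pmf)
    qed simp
    also have "\<dots> / length \<phi> = pmf (pmf_of_set ?Z) (i, j)"
      using f c fz nz cz by (auto simp: indicator_def)
    finally show "pmf (question_dist (clause_variable_game N \<phi>)) p = pmf (pmf_of_set ?Z) p"
      using p by simp
  qed
  also have "?Z = {(i, j). i < length \<phi> \<and> j \<in> clause_vars (\<phi> ! i)}" by auto
  finally show ?thesis .
qed

lemma two_prover_game_clause_variable_game:
  assumes "regular_3sat d N \<phi>" "\<phi> \<noteq> []"
  shows "two_prover_game (clause_variable_game N \<phi>)"
proof -
  let ?A = "{a :: nat \<rightharpoonup> bool. \<exists>i<length \<phi>. dom a = clause_vars (\<phi> ! i)}"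
  have sub: "clause_vars (\<phi> ! i) \<subseteq> {..<N}" if "i < length \<phi>" for i
    using assms that by (auto simp: regular_3sat_def)
  have "?A = (\<Union>i<length \<phi>. {a. dom a = clause_vars (\<phi> ! i) \<and> ran a \<subseteq> UNIV})" by auto
  also have "finite \<dots>"
    using sub by (intro finite_UN_I finite_set_of_finite_maps) (auto intro: finite_subset)
  finally have "finite ?A" .
  moreover have "(\<lambda>j. if j \<in> clause_vars (\<phi> ! 0) then Some True else None) \<in> ?A"
    using assms by (auto simp: dom_def intro!: exI[of _ 0])
  hence "?A \<noteq> {}" by blast
  ultimately show ?thesis
    using sub set_pmf_clause_variable_game[OF assms]
    unfolding two_prover_game_def by (auto simp: clause_variable_game_def)
qed

lemma k_subsets_finite_nonempty:
  assumes "finite X" "k \<le> card X"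
  shows "finite (k_subsets X k)" "k_subsets X k \<noteq> {}"
  using assms obtain_subset_with_card_n[of k X] by (auto simp: k_subsets_def)

lemma two_prover_game_birthday_repetition:
  assumes G: "two_prover_game G" and k: "k \<le> card (questions1 G)" and l: "l \<le> card (questions2 G)"
  shows "two_prover_game (birthday_repetition G k l)"
proof -
  have 1: "finite (k_subsets (questions1 G) k)" "k_subsets (questions1 G) k \<noteq> {}"
    and 2: "finite (k_subsets (questions2 G) l)" "k_subsets (questions2 G) l \<noteq> {}"
    using assms k_subsets_finite_nonempty by (auto simp: two_prover_game_def)
  have "finite S" if "S \<in> k_subsets (questions1 G) k" for S
    using that G by (auto simp: k_subsets_def two_prover_game_def intro: finite_subset)
  moreover have "finite T" if "T \<in> k_subsets (questions2 G) l" for T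
    using that G by (auto simp: k_subsets_def two_prover_game_def intro: finite_subset)
  ultimately show ?thesis
    using 1 2 G unfolding two_prover_game_def
    by (auto simp: birthday_repetition_def PiE_eq_empty_iff intro!: finite_PiE)
qed

end

theory Submission
  imports Defs
begin

text \<open>
  Given a strategy for the repeated game, prover 1 on \<open>x\<close> samples a uniform \<open>k\<close>-set \<open>S\<close> containing
  \<open>x\<close> and answers as on \<open>S\<close>, prover 2 on \<open>y\<close> samples a uniform \<open>l\<close>-set \<open>T\<close> containing \<open>y\<close>; they win
  whenever \<open>(S, T)\<close> is accepted.  The pair \<open>(S, T)\<close> then has a density proportional to
  \<open>e(S, T) = card (Z \<inter> S \<times> T)\<close> with respect to the uniform distribution.  Edges of \<open>Z\<close> without a
  common endpoint are negatively correlated, so the variance of \<open>e\<close> is at most its mean \<open>\<mu>\<close> times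
  \<open>1 + d\<^sub>1 + d\<^sub>2\<close>.  By Cauchy-Schwarz the loss is at most \<open>sqrt ((1 + d\<^sub>1 + d\<^sub>2) / \<mu>)\<close>, where
  \<open>\<mu> = d\<^sub>1 k l / card Y\<close>.  Finally the random choices are fixed by averaging.
\<close>

section \<open>Membership of one and of two points in a uniformly random
  \<open>k\<close>-subset\<close>

lemma card_k_subsets: "finite X \<Longrightarrow> card (k_subsets X k) = card X choose k"
  by (simp add: k_subsets_def n_subsets)

text \<open>Deleting \<open>A\<close> is a bijection onto the \<open>(k - card A)\<close>-subsets of
  \<open>X - A\<close>, with inverse adding \<open>A\<close> back.\<close>

lemma card_k_subsets_superset:
  assumes "finite X" "A \<subseteq> X" "card A \<le> k"
  shows "card {S \<in> k_subsets X k. A \<subseteq> S} = (card X - card A) choose (k - card A)"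
proof -
  have fA: "finite A"
    using assms finite_subset by blast
  have "bij_betw (\<lambda>S. S - A) {S \<in> k_subsets X k. A \<subseteq> S} (k_subsets (X - A) (k - card A))"
  proof (rule bij_betw_byWitness[where f' = "\<lambda>S. S \<union> A"])
    show "(\<lambda>S. S \<union> A) ` k_subsets (X - A) (k - card A) \<subseteq> {S \<in> k_subsets X k. A \<subseteq> S}"
    proof clarsimp
      fix S assume S: "S \<in> k_subsets (X - A) (k - card A)"
      then have "finite S" "S \<inter> A = {}"
        using assms finite_subset by (auto simp: k_subsets_def)
      then show "S \<union> A \<in> k_subsets X k"
        using S assms fA by (auto simp: k_subsets_def card_Un_disjoint)
    qed
  qed (use fA in \<open>auto simp: k_subsets_def card_Diff_subset\<close>)
  then show ?thesis
    using assms fA by (simp add: bij_betw_same_card card_k_subsets card_Diff_subset)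
qed

text \<open>The probability \<open>k / card X\<close> that a random \<open>k\<close>-set contains
  \<open>x\<close>. Expectations are kept as plain sums, with the number of subsets as a factor on
  the right.\<close>

lemma sum_k_subsets_mem:
  assumes "finite X" "x \<in> X" "1 \<le> k"
  shows "(\<Sum>S\<in>k_subsets X k. of_bool (x \<in> S) :: real)
           = real k / card X * card (k_subsets X k)"
proof -
  have fin: "finite (k_subsets X k)"
    using assms by (simp add: k_subsets_def)
  have "X \<noteq> {}"
    using assms by blast
  moreover have "card {S \<in> k_subsets X k. x \<in> S} = (card X - 1) choose (k - 1)"
    using card_k_subsets_superset[of X "{x}" k] assms by simp
  moreover have "k * (card X choose k) = card X * ((card X - 1) choose (k - 1))"
    using assms by (intro times_binomial_minus1_eq) simp
  then have "real k * real (card X choose k) = real (card X) * real ((card X - 1) choose (k - 1))"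
    by (metis of_nat_mult)
  ultimately show ?thesis
    using assms fin by (simp add: card_k_subsets field_simps Int_def flip: sum.inter_filter)
qed

lemma sum_k_subsets_mem2_le:
  assumes "finite X" "x \<in> X" "x' \<in> X" "1 \<le> k" "k \<le> card X"
  shows "(\<Sum>S\<in>k_subsets X k. of_bool (x \<in> S) * of_bool (x' \<in> S) :: real)
           \<le> ((real k / card X)\<^sup>2 + of_bool (x = x') * (real k / card X)) * card (k_subsets X k)"
proof (cases "x = x'")
  case True
  have "(\<Sum>S\<in>k_subsets X k. of_bool (x \<in> S) * of_bool (x' \<in> S) :: real)
      = (\<Sum>S\<in>k_subsets X k. of_bool (x \<in> S))"
    using True by (intro sum.cong) auto
  then show ?thesis
    using True sum_k_subsets_mem[OF assms(1,2,4)] by (simp add: field_simps)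
next
  case False
  have fin: "finite (k_subsets X k)"
    using assms by (simp add: k_subsets_def)
  have eq: "(\<Sum>S\<in>k_subsets X k. of_bool (x \<in> S) * of_bool (x' \<in> S) :: real)
      = card {S \<in> k_subsets X k. {x, x'} \<subseteq> S}"
    using fin by (simp add: Int_def flip: sum.inter_filter of_bool_conj)
  show ?thesis
  \<comment> \<open>The superset count for two distinct points needs \<open>2 \<le> k\<close>; a
    singleton contains no two distinct points.\<close>
  proof (cases "k = 1")
    case True
    then have "{S \<in> k_subsets X k. {x, x'} \<subseteq> S} = {}"
      using False by (auto simp: k_subsets_def card_1_singleton_iff)
    then show ?thesis
      unfolding eq by (simp only: card.empty) simp
  next
    case k: False
    define n where "n = card X"
    define m where "m = ((n - 2) choose (k - 2))"
    have n: "2 \<le> k" "k \<le> n"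
      using k assms by (auto simp: n_def)
    have "k * (n choose k) = n * ((n - 1) choose (k - 1))"
      using n by (intro times_binomial_minus1_eq) simp
    moreover have "(k - 1) * ((n - 1) choose (k - 1)) = (n - 1) * m"
      using n times_binomial_minus1_eq[of "k - 1" "n - 1"]
      by (simp add: m_def numeral_2_eq_2)
    ultimately have "(k - 1) * (k * (n choose k)) = n * ((n - 1) * m)"
      by (metis mult.left_commute)
    then have "real (k - 1) * (real k * real (n choose k)) = real n * (real (n - 1) * real m)"
      by (metis of_nat_mult)
    then have "(real k - 1) * (real k * real (n choose k)) = real n * ((real n - 1) * real m)"
      using n by (simp add: of_nat_diff)
    then have m: "real m = (real k / n) * ((real k - 1) / (real n - 1)) * (n choose k)"
      using n by (simp add: field_simps)
    \<comment> \<open>With denominators cleared this is just \<open>k \<le> n\<close>.\<close>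
    have "(real k - 1) / (real n - 1) \<le> real k / n"
      using n by (simp add: field_simps)
    then have "real m \<le> (real k / n)\<^sup>2 * (n choose k)"
      unfolding m power2_eq_square by (intro mult_right_mono mult_left_mono) auto
    moreover have "card {S \<in> k_subsets X k. {x, x'} \<subseteq> S} = m"
      using card_k_subsets_superset[of X "{x, x'}" k] n assms False
      by (simp add: m_def n_def numeral_2_eq_2)
    ultimately show ?thesis
      using False eq assms by (simp add: n_def card_k_subsets)
  qed
qed

lemma exists_ge_average:
  fixes f :: "'a \<Rightarrow> real"
  assumes "finite A" "A \<noteq> {}"
  shows "\<exists>a\<in>A. sum f A / card A \<le> f a"
proof (rule ccontr)
  assume "\<not> ?thesis"
  then have "sum f A < (\<Sum>a\<in>A. sum f A / card A)"
    using assms by (intro sum_strict_mono) auto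
  then show False
    using assms by simp
qed

section \<open>The number of edges of a biregular bipartite graph inside a random box
  \<open>S \<times> T\<close>\<close>

locale biregular =
  fixes X :: "'x set" and Y :: "'y set" and Z :: "('x \<times> 'y) set"
    and d\<^sub>1 d\<^sub>2 k l :: nat
  assumes finite_X: "finite X" and finite_Y: "finite Y" and Z_sub: "Z \<subseteq> X \<times> Y"
    and degree1: "x \<in> X \<Longrightarrow> card {y. (x, y) \<in> Z} = d\<^sub>1"
    and degree2: "y \<in> Y \<Longrightarrow> card {x. (x, y) \<in> Z} = d\<^sub>2"
    and d\<^sub>1_pos: "0 < d\<^sub>1"
    and k: "1 \<le> k" "k \<le> card X" and l: "1 \<le> l" "l \<le> card Y"
begin

abbreviation "KS \<equiv> k_subsets X k"
abbreviation "LS \<equiv> k_subsets Y l"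

text \<open>A sum of indicators instead of a cardinality, so that sums over boxes can be exchanged
  with the sum over edges.\<close>

definition edges :: "'x set \<Rightarrow> 'y set \<Rightarrow> real" where
  "edges S T = (\<Sum>(x, y)\<in>Z. of_bool (x \<in> S) * of_bool (y \<in> T))"

text \<open>Linearity of expectation gives this formula: \<open>S\<close> and \<open>T\<close> are
  independent, so an edge lies in the box with probability the product of the two ratios. That it is
  the average of \<open>edges\<close> is \<open>sum_edges\<close>.\<close>

definition mean :: real where
  "mean = card Z * (real k / card X) * (real l / card Y)"

lemma finite_Z: "finite Z"
  using Z_sub finite_X finite_Y finite_subset by blast

lemma finite_KS: "finite KS" and KS_nonempty: "KS \<noteq> {}"
  and finite_LS: "finite LS" and LS_nonempty: "LS \<noteq> {}"
  using k_subsets_finite_nonempty finite_X finite_Y k l by blast+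

lemma card_KS_pos: "0 < card KS" and card_LS_pos: "0 < card LS"
  using finite_KS KS_nonempty finite_LS LS_nonempty by (auto simp: card_gt_0_iff)

text \<open>Passes from random boxes weighted by their edge count to an edge together with a box
  containing it. Used with \<open>f\<close> constantly 1 for the first moment, and with general
  \<open>f\<close> to extract strategies.\<close>

lemma sum_edges_weighted:
  "(\<Sum>S\<in>KS. \<Sum>T\<in>LS. edges S T * f S T) =
     (\<Sum>(x, y)\<in>Z. \<Sum>S\<in>KS. \<Sum>T\<in>LS. of_bool (x \<in> S) * of_bool (y \<in> T) * f S T)"
proof -
  have "(\<Sum>S\<in>KS. \<Sum>T\<in>LS. edges S T * f S T) =
      (\<Sum>S\<in>KS. \<Sum>z\<in>Z. \<Sum>T\<in>LS. of_bool (fst z \<in> S) * of_bool (snd z \<in> T) * f S T)"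
    by (intro sum.cong refl, subst sum.swap)
      (simp add: edges_def sum_distrib_right split_beta)
  then show ?thesis
    by (subst (asm) sum.swap) (simp add: split_beta)
qed

lemma sum_edges: "(\<Sum>S\<in>KS. \<Sum>T\<in>LS. edges S T) = mean * (card KS * card LS)"
proof -
  have "(\<Sum>S\<in>KS. \<Sum>T\<in>LS. edges S T) =
      (\<Sum>(x, y)\<in>Z. (\<Sum>S\<in>KS. of_bool (x \<in> S)) * (\<Sum>T\<in>LS. of_bool (y \<in> T)))"
    using sum_edges_weighted[of "\<lambda>_ _. 1"] by (simp add: sum_product)
  also have "\<dots> = (\<Sum>(x, y)\<in>Z. (real k / card X * card KS) * (real l / card Y * card LS))"
    using Z_sub finite_X finite_Y k l
    by (intro sum.cong) (auto simp: sum_k_subsets_mem)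
  finally show ?thesis
    by (simp add: mean_def)
qed

lemma card_Z1: "card Z = card X * d\<^sub>1"
proof -
  have "card Z = card (Sigma X (\<lambda>x. {y. (x, y) \<in> Z}))"
    using Z_sub by (intro arg_cong[of _ _ card]) auto
  also have "\<dots> = (\<Sum>x\<in>X. card {y. (x, y) \<in> Z})"
    using finite_X by (intro card_SigmaI ballI finite_subset[OF _ finite_Y]) (use Z_sub in auto)
  finally show ?thesis
    by (simp add: degree1)
qed

lemma mean_pos: "0 < mean"
  using k l d\<^sub>1_pos by (simp add: mean_def card_Z1)

section \<open>Second moment and deviation of the edge count, through pairs of edges sharing an
  endpoint\<close>

lemma sum_same1: "(\<Sum>z\<in>Z. \<Sum>z'\<in>Z. of_bool (fst z = fst z')) = real (card Z * d\<^sub>1)"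
proof -
  have "(\<Sum>z'\<in>Z. of_bool (fst z = fst z')) = real d\<^sub>1" if "z \<in> Z" for z
  proof -
    have "{z' \<in> Z. fst z = fst z'} = Pair (fst z) ` {y. (fst z, y) \<in> Z}"
      by force
    then have "card {z' \<in> Z. fst z = fst z'} = d\<^sub>1"
      using that Z_sub degree1[of "fst z"] by (auto simp: card_image inj_on_def)
    then show ?thesis
      using finite_Z by (simp add: Int_def flip: sum.inter_filter)
  qed
  then show ?thesis
    by simp
qed

lemma sum_same2: "(\<Sum>z\<in>Z. \<Sum>z'\<in>Z. of_bool (snd z = snd z')) = real (card Z * d\<^sub>2)"
proof -
  have "(\<Sum>z'\<in>Z. of_bool (snd z = snd z')) = real d\<^sub>2" if "z \<in> Z" for z
  proof -
    have "{z' \<in> Z. snd z = snd z'} = (\<lambda>x. (x, snd z)) ` {x. (x, snd z) \<in> Z}"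
      by force
    then have "card {z' \<in> Z. snd z = snd z'} = d\<^sub>2"
      using that Z_sub degree2[of "snd z"] by (auto simp: card_image inj_on_def)
    then show ?thesis
      using finite_Z by (simp add: Int_def flip: sum.inter_filter)
  qed
  then show ?thesis
    by simp
qed

text \<open>Squaring gives a sum over ordered pairs of edges, and each summand factors because
  \<open>S\<close> and \<open>T\<close> are independent. Beyond \<open>mean\<^sup>2\<close>, pairs
  with a common left endpoint, a common right endpoint, and equal pairs contribute at most
  \<open>mean\<close> times \<open>d\<^sub>1\<close>, \<open>d\<^sub>2\<close> and 1.\<close>

lemma sum_edges_squared:
  "(\<Sum>S\<in>KS. \<Sum>T\<in>LS. (edges S T)\<^sup>2) \<le>
     (mean\<^sup>2 + mean * (1 + d\<^sub>1 + d\<^sub>2)) * (card KS * card LS)"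
proof -
  define p q where "p = real k / card X" and "q = real l / card Y"
  have pq: "0 \<le> p" "p \<le> 1" "0 \<le> q" "q \<le> 1"
    using k l by (auto simp: p_def q_def)
  let ?I = "\<lambda>a b. of_bool (a = b) :: real"
  have "(\<Sum>S\<in>KS. \<Sum>T\<in>LS. (edges S T)\<^sup>2) =
      (\<Sum>z\<in>Z. \<Sum>z'\<in>Z. (\<Sum>S\<in>KS. of_bool (fst z \<in> S) * of_bool (fst z' \<in> S)) *
         (\<Sum>T\<in>LS. of_bool (snd z \<in> T) * of_bool (snd z' \<in> T)))" (is "_ = ?R")
  proof -
    have "(\<Sum>S\<in>KS. \<Sum>T\<in>LS. (edges S T)\<^sup>2) = (\<Sum>S\<in>KS. \<Sum>T\<in>LS. \<Sum>z\<in>Z. \<Sum>z'\<in>Z.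
        (of_bool (fst z \<in> S) * of_bool (fst z' \<in> S)) * (of_bool (snd z \<in> T) * of_bool (snd z' \<in> T)))"
      by (simp only: edges_def power2_eq_square sum_product split_beta mult_ac)
    \<comment> \<open>Swaps of neighbouring sums carry the order \<open>S, T, z, z'\<close> to
      \<open>z, z', S, T\<close>.\<close>
    also have "\<dots> = (\<Sum>S\<in>KS. \<Sum>z\<in>Z. \<Sum>T\<in>LS. \<Sum>z'\<in>Z.
        (of_bool (fst z \<in> S) * of_bool (fst z' \<in> S)) * (of_bool (snd z \<in> T) * of_bool (snd z' \<in> T)))"
      by (intro sum.cong refl sum.swap)
    also have "\<dots> = (\<Sum>z\<in>Z. \<Sum>S\<in>KS. \<Sum>z'\<in>Z. \<Sum>T\<in>LS.
        (of_bool (fst z \<in> S) * of_bool (fst z' \<in> S)) * (of_bool (snd z \<in> T) * of_bool (snd z' \<in> T)))"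
      by (subst sum.swap) (intro sum.cong refl sum.swap)
    also have "\<dots> = (\<Sum>z\<in>Z. \<Sum>z'\<in>Z. \<Sum>S\<in>KS. \<Sum>T\<in>LS.
        (of_bool (fst z \<in> S) * of_bool (fst z' \<in> S)) * (of_bool (snd z \<in> T) * of_bool (snd z' \<in> T)))"
      by (intro sum.cong refl sum.swap)
    also have "\<dots> = ?R"
      by (simp only: sum_product)
    finally show ?thesis .
  qed
  also have "\<dots> \<le> (\<Sum>z\<in>Z. \<Sum>z'\<in>Z. ((p\<^sup>2 + ?I (fst z) (fst z') * p) * card KS) *
      ((q\<^sup>2 + ?I (snd z) (snd z') * q) * card LS))"
    unfolding p_def q_def using Z_sub k l
    by (intro sum_mono mult_mono sum_k_subsets_mem2_le finite_X finite_Y)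
      (auto intro!: sum_nonneg)
  \<comment> \<open>Agreement in both endpoints is equality of the edges, which gives the last of
    the four terms.\<close>
  also have "\<dots> = (\<Sum>z\<in>Z. \<Sum>z'\<in>Z. p\<^sup>2 * q\<^sup>2 + p * q\<^sup>2 * ?I (fst z) (fst z')
      + p\<^sup>2 * q * ?I (snd z) (snd z') + p * q * ?I z z') * (card KS * card LS)"
    unfolding sum_distrib_right
    by (intro sum.cong refl) (auto simp: algebra_simps prod_eq_iff)
  also have "(\<Sum>z\<in>Z. \<Sum>z'\<in>Z. p\<^sup>2 * q\<^sup>2 + p * q\<^sup>2 * ?I (fst z) (fst z')
      + p\<^sup>2 * q * ?I (snd z) (snd z') + p * q * ?I z z') =
      (card Z * p * q)\<^sup>2 + p * q\<^sup>2 * (card Z * d\<^sub>1) + p\<^sup>2 * q * (card Z * d\<^sub>2) + p * q * card Z"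
  proof -
    have "(\<Sum>z\<in>Z. \<Sum>z'\<in>Z. ?I z z') = card Z"
      using finite_Z by simp
    then show ?thesis
      using sum_same1 sum_same2
      by (simp add: sum.distrib power2_eq_square flip: sum_distrib_left)
  qed
  also have "\<dots> \<le> mean\<^sup>2 + mean * (1 + d\<^sub>1 + d\<^sub>2)"
  proof -
    have m: "mean = card Z * p * q"
      by (simp add: mean_def p_def q_def)
    have "p * q\<^sup>2 * (card Z * d\<^sub>1) = mean * d\<^sub>1 * q" "p\<^sup>2 * q * (card Z * d\<^sub>2) = mean * d\<^sub>2 * p"
      by (simp_all add: m power2_eq_square)
    \<comment> \<open>The leftover probabilities \<open>q\<close> and \<open>p\<close> are bounded
      by 1.\<close>
    moreover have "mean * d\<^sub>1 * q \<le> mean * d\<^sub>1" "mean * d\<^sub>2 * p \<le> mean * d\<^sub>2"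
      using pq mean_pos by (auto intro!: mult_left_le)
    moreover have "(card Z * p * q)\<^sup>2 = mean\<^sup>2" "p * q * card Z = mean"
      by (simp_all add: m)
    ultimately show ?thesis
      by (simp only: distrib_left of_nat_add of_nat_1 mult_1_right)
  qed
  finally show ?thesis
    by (simp add: mult_right_mono)
qed

text \<open>The second moment bounds the variance; Cauchy-Schwarz against the constant 1 on
  \<open>KS \<times> LS\<close> turns this into a bound on the mean absolute deviation.\<close>

lemma sum_deviation:
  "(\<Sum>S\<in>KS. \<Sum>T\<in>LS. \<bar>edges S T - mean\<bar>) \<le>
     sqrt (mean * (1 + d\<^sub>1 + d\<^sub>2)) * (card KS * card LS)"
proof -
  let ?n = "real (card KS * card LS)"
  have "(\<Sum>S\<in>KS. \<Sum>T\<in>LS. (edges S T - mean)\<^sup>2) =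
      (\<Sum>S\<in>KS. \<Sum>T\<in>LS. (edges S T)\<^sup>2) - 2 * mean * (\<Sum>S\<in>KS. \<Sum>T\<in>LS. edges S T) + ?n * mean\<^sup>2"
    by (simp add: power2_diff sum.distrib sum_subtractf sum_distrib_left mult_ac)
  also have "\<dots> \<le> mean * (1 + d\<^sub>1 + d\<^sub>2) * ?n"
    using sum_edges_squared unfolding sum_edges by (simp add: algebra_simps power2_eq_square)
  finally have var: "(\<Sum>S\<in>KS. \<Sum>T\<in>LS. (edges S T - mean)\<^sup>2) \<le> mean * (1 + d\<^sub>1 + d\<^sub>2) * ?n" .
  have "(\<Sum>S\<in>KS. \<Sum>T\<in>LS. \<bar>edges S T - mean\<bar>)\<^sup>2 \<le>
      (\<Sum>S\<in>KS. \<Sum>T\<in>LS. (edges S T - mean)\<^sup>2) * ?n"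
    using sum_squared_le_sum_of_squares[of "\<lambda>(S, T). \<bar>edges S T - mean\<bar>" "KS \<times> LS"]
    by (simp add: sum.cartesian_product split_beta card_cartesian_product)
  also have "\<dots> \<le> mean * (1 + d\<^sub>1 + d\<^sub>2) * ?n * ?n"
    using var by (intro mult_right_mono) auto
  also have "\<dots> = (sqrt (mean * (1 + d\<^sub>1 + d\<^sub>2)) * ?n)\<^sup>2"
    using mean_pos by (simp add: power_mult_distrib power2_eq_square)
  finally show ?thesis
    by (rule power2_le_imp_le) (use mean_pos in simp)
qed

section \<open>From uniform boxes to deterministic choices of boxes for single questions\<close>

lemma average_deviation:
  assumes "\<And>S T. 0 \<le> f S T" "\<And>S T. f S T \<le> 1"
  shows "(\<Sum>S\<in>KS. \<Sum>T\<in>LS. f S T) / (card KS * card LS) - sqrt ((1 + d\<^sub>1 + d\<^sub>2) / mean)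
           \<le> (\<Sum>S\<in>KS. \<Sum>T\<in>LS. edges S T * f S T) / (mean * (card KS * card LS))"
proof -
  let ?n = "real (card KS * card LS)"
  have n: "0 < ?n"
    using card_KS_pos card_LS_pos by simp
  \<comment> \<open>Change of measure from the uniform distribution to density
    \<open>edges / mean\<close>: since \<open>f\<close> lies between 0 and 1, its average drops by
    at most the L1 distance of the densities, here scaled by \<open>mean\<close>.\<close>
  have "mean * (\<Sum>S\<in>KS. \<Sum>T\<in>LS. f S T) - (\<Sum>S\<in>KS. \<Sum>T\<in>LS. edges S T * f S T) =
      (\<Sum>S\<in>KS. \<Sum>T\<in>LS. (mean - edges S T) * f S T)"
    by (simp add: sum_subtractf sum_distrib_left left_diff_distrib)
  also have "\<dots> \<le> (\<Sum>S\<in>KS. \<Sum>T\<in>LS. \<bar>edges S T - mean\<bar>)"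
  proof (intro sum_mono)
    fix S T
    have "(mean - edges S T) * f S T \<le> \<bar>edges S T - mean\<bar> * f S T"
      using assms by (intro mult_right_mono) auto
    also have "\<dots> \<le> \<bar>edges S T - mean\<bar>"
      using assms by (intro mult_left_le) auto
    finally show "(mean - edges S T) * f S T \<le> \<bar>edges S T - mean\<bar>" .
  qed
  also have "\<dots> \<le> sqrt (mean * (1 + d\<^sub>1 + d\<^sub>2)) * ?n"
    by (rule sum_deviation)
  also have "sqrt (mean * (1 + d\<^sub>1 + d\<^sub>2)) = mean * sqrt ((1 + d\<^sub>1 + d\<^sub>2) / mean)"
    using mean_pos by (simp add: real_sqrt_mult real_sqrt_divide real_div_sqrt mult_ac flip: times_divide_eq_left)
  finally have "mean * (\<Sum>S\<in>KS. \<Sum>T\<in>LS. f S T) - mean * sqrt ((1 + d\<^sub>1 + d\<^sub>2) / mean) * ?n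
      \<le> (\<Sum>S\<in>KS. \<Sum>T\<in>LS. edges S T * f S T)"
    by linarith
  moreover have "mean * (\<Sum>S\<in>KS. \<Sum>T\<in>LS. f S T) - mean * sqrt ((1 + d\<^sub>1 + d\<^sub>2) / mean) * ?n
      = ((\<Sum>S\<in>KS. \<Sum>T\<in>LS. f S T) / ?n - sqrt ((1 + d\<^sub>1 + d\<^sub>2) / mean)) * (mean * ?n)"
    using n by (simp add: left_diff_distrib del: of_nat_mult)
  ultimately show ?thesis
    using mean_pos n by (subst pos_le_divide_eq) (simp_all del: of_nat_mult)
qed

text \<open>The left-hand side is the expectation of \<open>f S T\<close> when \<open>(x, y)\<close>
  is uniform in \<open>Z\<close>, \<open>S\<close> is uniform among the \<open>k\<close>-sets
  containing \<open>x\<close>, and \<open>T\<close> among the \<open>l\<close>-sets containing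
  \<open>y\<close>. First \<open>t\<close> is fixed against random \<open>S\<close>, then
  \<open>s\<close> against that \<open>t\<close>. Each time the total splits into a sum over
  questions, so every question can be treated separately.\<close>

lemma exists_choice:
  fixes f :: "'x set \<Rightarrow> 'y set \<Rightarrow> real"
  obtains s t where "\<And>x. x \<in> X \<Longrightarrow> x \<in> s x \<and> s x \<in> KS" "\<And>y. y \<in> Y \<Longrightarrow> y \<in> t y \<and> t y \<in> LS"
    "(\<Sum>S\<in>KS. \<Sum>T\<in>LS. edges S T * f S T) / (mean * (card KS * card LS))
       \<le> (\<Sum>(x, y)\<in>Z. f (s x) (t y)) / card Z"
proof -
  define p q where "p = real k / card X * card KS" and "q = real l / card Y * card LS"
  have pq: "0 < p" "0 < q"
    using k l card_KS_pos card_LS_pos by (auto simp: p_def q_def)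
  let ?K = "\<lambda>x. {S \<in> KS. x \<in> S}" and ?L = "\<lambda>y. {T \<in> LS. y \<in> T}"
  \<comment> \<open>The number of sets containing a question is the same for all questions; this is
    what makes the density proportional to \<open>edges\<close>.\<close>
  have cK: "real (card (?K x)) = p" if "x \<in> X" for x
    using sum_k_subsets_mem[OF finite_X that k(1)] finite_KS
    by (simp add: p_def Int_def flip: sum.inter_filter)
  have cL: "real (card (?L y)) = q" if "y \<in> Y" for y
    using sum_k_subsets_mem[OF finite_Y that l(1)] finite_LS
    by (simp add: q_def Int_def flip: sum.inter_filter)
  have neK: "?K x \<noteq> {}" if "x \<in> X" for x
    using cK[OF that] pq by fastforce
  have neL: "?L y \<noteq> {}" if "y \<in> Y" for y
    using cL[OF that] pq by fastforce
  \<comment> \<open>Unnormalised gain of choosing \<open>T\<close> on question \<open>y\<close>,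
    with the set of the other prover still random.\<close>
  define h where "h y T = (\<Sum>x\<in>{x. (x, y) \<in> Z}. \<Sum>S\<in>?K x. f S T)" for y T
  have "\<exists>T\<in>?L y. sum (h y) (?L y) / q \<le> h y T" if "y \<in> Y" for y
    unfolding cL[OF that, symmetric] using finite_LS neL[OF that] by (intro exists_ge_average) auto
  then have "\<forall>y\<in>Y. \<exists>T. T \<in> ?L y \<and> sum (h y) (?L y) / q \<le> h y T"
    by blast
  from bchoice[OF this] obtain t where t: "\<And>y. y \<in> Y \<Longrightarrow> t y \<in> ?L y"
      "\<And>y. y \<in> Y \<Longrightarrow> sum (h y) (?L y) / q \<le> h y (t y)"
    by blast
  \<comment> \<open>The analogous gain of choosing \<open>S\<close> on question \<open>x\<close>,
    now with \<open>t\<close> already fixed.\<close>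
  define g where "g x S = (\<Sum>y\<in>{y. (x, y) \<in> Z}. f S (t y))" for x S
  have "\<exists>S\<in>?K x. sum (g x) (?K x) / p \<le> g x S" if "x \<in> X" for x
    unfolding cK[OF that, symmetric] using finite_KS neK[OF that] by (intro exists_ge_average) auto
  then have "\<forall>x\<in>X. \<exists>S. S \<in> ?K x \<and> sum (g x) (?K x) / p \<le> g x S"
    by blast
  from bchoice[OF this] obtain s where s: "\<And>x. x \<in> X \<Longrightarrow> s x \<in> ?K x"
      "\<And>x. x \<in> X \<Longrightarrow> sum (g x) (?K x) / p \<le> g x (s x)"
    by blast
  have Z1: "(\<Sum>(x, y)\<in>Z. F x y) = (\<Sum>x\<in>X. \<Sum>y\<in>{y. (x, y) \<in> Z}. F x y)" for F :: "'x \<Rightarrow> 'y \<Rightarrow> real"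
  proof -
    have "finite {y. (x, y) \<in> Z}" for x
      by (rule finite_subset[OF _ finite_Y]) (use Z_sub in auto)
    then have "(\<Sum>x\<in>X. \<Sum>y\<in>{y. (x, y) \<in> Z}. F x y) = (\<Sum>(x, y)\<in>Sigma X (\<lambda>x. {y. (x, y) \<in> Z}). F x y)"
      using finite_X by (intro sum.Sigma) auto
    also have "Sigma X (\<lambda>x. {y. (x, y) \<in> Z}) = Z"
      using Z_sub by auto
    finally show ?thesis ..
  qed
  have Z2: "(\<Sum>(x, y)\<in>Z. F x y) = (\<Sum>y\<in>Y. \<Sum>x\<in>{x. (x, y) \<in> Z}. F x y)" for F :: "'x \<Rightarrow> 'y \<Rightarrow> real"
  proof -
    have "{y. (x, y) \<in> Z} = {y \<in> Y. (x, y) \<in> Z}" "{x. (x, y) \<in> Z} = {x \<in> X. (x, y) \<in> Z}" for x y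
      using Z_sub by auto
    then show ?thesis
      using sum.swap_restrict[OF finite_X finite_Y, of F "\<lambda>x y. (x, y) \<in> Z"] by (simp add: Z1)
  qed
  have "(\<Sum>S\<in>KS. \<Sum>T\<in>LS. edges S T * f S T) = (\<Sum>(x, y)\<in>Z. \<Sum>S\<in>?K x. \<Sum>T\<in>?L y. f S T)"
    unfolding sum_edges_weighted sum.inter_filter[OF finite_KS] sum.inter_filter[OF finite_LS]
    by (intro sum.cong refl) (auto intro!: sum.cong)
  also have "\<dots> = (\<Sum>y\<in>Y. sum (h y) (?L y))"
    unfolding Z2 h_def
    by (intro sum.cong refl, subst sum.swap[of _ "?L _"]) (intro sum.cong refl sum.swap)
  also have "\<dots> \<le> (\<Sum>y\<in>Y. q * h y (t y))"
    using t(2) pq by (intro sum_mono) (simp add: field_simps)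
  also have "\<dots> = q * (\<Sum>(x, y)\<in>Z. \<Sum>S\<in>?K x. f S (t y))"
    by (simp add: Z2 h_def sum_distrib_left)
  also have "(\<Sum>(x, y)\<in>Z. \<Sum>S\<in>?K x. f S (t y)) = (\<Sum>x\<in>X. sum (g x) (?K x))"
    unfolding Z1 g_def by (intro sum.cong refl sum.swap)
  also have "q * \<dots> \<le> q * (\<Sum>x\<in>X. p * g x (s x))"
    using s(2) pq by (intro mult_left_mono sum_mono) (simp_all add: field_simps)
  also have "(\<Sum>x\<in>X. p * g x (s x)) = p * (\<Sum>(x, y)\<in>Z. f (s x) (t y))"
    by (simp add: Z1 g_def sum_distrib_left)
  finally have main: "(\<Sum>S\<in>KS. \<Sum>T\<in>LS. edges S T * f S T) \<le> q * (p * (\<Sum>(x, y)\<in>Z. f (s x) (t y)))" .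
  have pos: "0 < real (card Z)"
    using k d\<^sub>1_pos by (simp add: card_Z1)
  \<comment> \<open>Both sides count the triples of an edge and the two sides of a box containing
    it, so the normalisations agree.\<close>
  have "mean * (card KS * card LS) = card Z * (p * q)"
    by (simp add: mean_def p_def q_def)
  then have "(\<Sum>S\<in>KS. \<Sum>T\<in>LS. edges S T * f S T) / (mean * (card KS * card LS))
       \<le> (\<Sum>(x, y)\<in>Z. f (s x) (t y)) / card Z"
    using main pq pos by (simp add: field_simps)
  then show thesis
    using that s(1) t(1) by blast
qed

end

section \<open>Game values and optimal strategies\<close>

lemma finite_strategy_values:
  assumes "two_prover_game G"
  shows "finite {success_prob G a b | a b.
    a \<in> questions1 G \<rightarrow>\<^sub>E answers1 G \<and> b \<in> questions2 G \<rightarrow>\<^sub>E answers2 G}" (is "finite ?A")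
proof -
  let ?P = "(questions1 G \<rightarrow>\<^sub>E answers1 G) \<times> (questions2 G \<rightarrow>\<^sub>E answers2 G)"
  have "finite ?P"
    using assms by (auto simp: two_prover_game_def intro!: finite_PiE)
  moreover have "?A = (\<lambda>(a, b). success_prob G a b) ` ?P"
    by auto
  ultimately show ?thesis
    by simp
qed

lemma success_prob_le_game_value:
  assumes "two_prover_game G"
    and "a \<in> questions1 G \<rightarrow>\<^sub>E answers1 G" "b \<in> questions2 G \<rightarrow>\<^sub>E answers2 G"
  shows "success_prob G a b \<le> game_value G"
  unfolding game_value_def using assms by (intro Max_ge finite_strategy_values) auto

lemma game_value_attained:
  assumes "two_prover_game G"
  obtains a b where "a \<in> questions1 G \<rightarrow>\<^sub>E answers1 G" "b \<in> questions2 G \<rightarrow>\<^sub>E answers2 G"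
    "game_value G = success_prob G a b"
proof -
  let ?A = "{success_prob G a b | a b.
    a \<in> questions1 G \<rightarrow>\<^sub>E answers1 G \<and> b \<in> questions2 G \<rightarrow>\<^sub>E answers2 G}"
  have "questions1 G \<rightarrow>\<^sub>E answers1 G \<noteq> {}" "questions2 G \<rightarrow>\<^sub>E answers2 G \<noteq> {}"
    using assms by (auto simp: two_prover_game_def PiE_eq_empty_iff)
  then have "?A \<noteq> {}"
    by blast
  then have "Max ?A \<in> ?A"
    using finite_strategy_values[OF assms] by (intro Max_in) auto
  then show thesis
    using that unfolding game_value_def by blast
qed

lemma expectation_pair_pmf_of_set:
  fixes f :: "'a \<times> 'b \<Rightarrow> real"
  assumes "finite A" "A \<noteq> {}" "finite B" "B \<noteq> {}"
  shows "measure_pmf.expectation (pair_pmf (pmf_of_set A) (pmf_of_set B)) f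
           = (\<Sum>a\<in>A. \<Sum>b\<in>B. f (a, b)) / (card A * card B)"
proof -
  have "pmf (pair_pmf (pmf_of_set A) (pmf_of_set B)) z = 1 / (card A * card B)" if "z \<in> A \<times> B" for z
    using assms that by (cases z) (simp add: pmf_pair indicator_def)
  then show ?thesis
    using assms
    by (subst integral_measure_pmf[of "A \<times> B"])
      (auto simp: sum.cartesian_product sum_divide_distrib split_beta intro!: sum.cong)
qed

text \<open>Acceptance of the box \<open>(s x, t y)\<close> forces verifier value 1 on all its
  edges, in particular on \<open>(x, y)\<close>. Restricting an optimal repeated strategy to these
  boxes thus wins \<open>G\<close> with at least the average of \<open>f (s x) (t y)\<close> over
  \<open>Z\<close>.\<close>

theorem birthday_repetition_value:
  assumes G: "two_prover_game G" and Z: "question_dist G = pmf_of_set Z"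
    and reg: "biregular (questions1 G) (questions2 G) Z d\<^sub>1 d\<^sub>2 k l"
  shows "game_value (birthday_repetition G k l)
           - sqrt ((1 + d\<^sub>1 + d\<^sub>2) / d\<^sub>1 * (card (questions2 G) / (real k * real l)))
         \<le> game_value G"
proof -
  interpret biregular "questions1 G" "questions2 G" Z d\<^sub>1 d\<^sub>2 k l
    by (rule reg)
  let ?B = "birthday_repetition G k l"
  obtain a b where "game_value ?B = success_prob ?B a b"
    using game_value_attained[OF two_prover_game_birthday_repetition[OF G k(2) l(2)]] by metis
  moreover define f where "f S T = verifier ?B S T (a S) (b T)" for S T
  ultimately have val: "game_value ?B = (\<Sum>S\<in>KS. \<Sum>T\<in>LS. f S T) / (card KS * card LS)"
    using finite_KS KS_nonempty finite_LS LS_nonempty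
    by (simp add: success_prob_def expectation_pair_pmf_of_set birthday_repetition_def)
  have f01: "0 \<le> f S T" "f S T \<le> 1" for S T
    by (auto simp: f_def birthday_repetition_def)
  have Zne: "Z \<noteq> {}"
    using mean_pos by (auto simp: mean_def)
  \<comment> \<open>The size of the first question set cancels, since \<open>Z\<close> has
    \<open>d\<^sub>1\<close> edges per first question.\<close>
  have mean: "mean = d\<^sub>1 * (real k * real l) / card (questions2 G)"
    using k by (simp add: mean_def card_Z1)
  obtain s t where s: "\<And>x. x \<in> questions1 G \<Longrightarrow> x \<in> s x \<and> s x \<in> KS"
    and t: "\<And>y. y \<in> questions2 G \<Longrightarrow> y \<in> t y \<and> t y \<in> LS"
    and st: "(\<Sum>S\<in>KS. \<Sum>T\<in>LS. edges S T * f S T) / (mean * (card KS * card LS))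
       \<le> (\<Sum>(x, y)\<in>Z. f (s x) (t y)) / card Z"
    using exists_choice[of f] by blast
  \<comment> \<open>Default answers: an answer of the repeated game may be a function on the wrong
    set, and its value at \<open>x\<close> or \<open>y\<close> then need not be legal in
    \<open>G\<close>. Such rounds are rejected, so there any legal answer does.\<close>
  obtain a0 b0 where ab0: "a0 \<in> answers1 G" "b0 \<in> answers2 G"
    using G by (auto simp: two_prover_game_def)
  define a' where "a' = (\<lambda>x\<in>questions1 G. if a (s x) x \<in> answers1 G then a (s x) x else a0)"
  define b' where "b' = (\<lambda>y\<in>questions2 G. if b (t y) y \<in> answers2 G then b (t y) y else b0)"
  have a': "a' \<in> questions1 G \<rightarrow>\<^sub>E answers1 G" and b': "b' \<in> questions2 G \<rightarrow>\<^sub>E answers2 G"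
    using ab0 by (auto simp: a'_def b'_def)
  have le: "f (s x) (t y) \<le> verifier G x y (a' x) (b' y)" if xy: "(x, y) \<in> Z" for x y
  proof (cases "f (s x) (t y) = 0")
    case True
    have "verifier G x y (a' x) (b' y) \<in> {0..1}"
      using G xy Z_sub a' b' unfolding two_prover_game_def by blast
    then show ?thesis
      using True by simp
  next
    case False
    have mem: "x \<in> questions1 G" "y \<in> questions2 G" "x \<in> s x" "y \<in> t y"
      using xy Z_sub s t by auto
    have acc: "a (s x) \<in> s x \<rightarrow>\<^sub>E answers1 G" "b (t y) \<in> t y \<rightarrow>\<^sub>E answers2 G"
      "\<forall>(x', y') \<in> (s x \<times> t y) \<inter> Z. verifier G x' y' (a (s x) x') (b (t y) y') = 1"
      using False Z Zne finite_Z
      by (auto simp: f_def birthday_repetition_def set_pmf_of_set)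
    have "a' x = a (s x) x" "b' y = b (t y) y"
      using acc(1,2) mem by (auto simp: a'_def b'_def)
    moreover have "verifier G x y (a (s x) x) (b (t y) y) = 1"
      using acc(3) mem xy by blast
    ultimately show ?thesis
      using f01(2) by simp
  qed
  have "game_value ?B - sqrt ((1 + d\<^sub>1 + d\<^sub>2) / mean) \<le> (\<Sum>(x, y)\<in>Z. f (s x) (t y)) / card Z"
    using average_deviation[of f] f01 st val by fastforce
  also have "\<dots> \<le> (\<Sum>(x, y)\<in>Z. verifier G x y (a' x) (b' y)) / card Z"
    using le by (intro divide_right_mono sum_mono) auto
  also have "\<dots> = success_prob G a' b'"
    using finite_Z Zne by (simp add: success_prob_def Z integral_pmf_of_set)
  also have "\<dots> \<le> game_value G"
    by (rule success_prob_le_game_value[OF G a' b'])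
  also have "(1 + d\<^sub>1 + d\<^sub>2) / mean = (1 + d\<^sub>1 + d\<^sub>2) / d\<^sub>1 * (card (questions2 G) / (real k * real l))"
    by (simp add: mean)
  finally show ?thesis
    by (simp only: of_nat_add of_nat_1)
qed

section \<open>The clause/variable game: degree 3 on clauses, degree \<open>d\<close> on
  variables\<close>

lemma biregular_clause_variable_game:
  assumes \<phi>: "regular_3sat d N \<phi>" and k: "k \<in> {1..length \<phi>}" and l: "l \<in> {1..N}"
  shows "biregular (questions1 (clause_variable_game N \<phi>)) (questions2 (clause_variable_game N \<phi>))
           {(i, j). i < length \<phi> \<and> j \<in> clause_vars (\<phi> ! i)} 3 d k l"
proof
  have c: "card (clause_vars (\<phi> ! i)) = 3" "clause_vars (\<phi> ! i) \<subseteq> {..<N}" if "i < length \<phi>" for i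
    using \<phi> that by (auto simp: regular_3sat_def)
  show "{(i, j). i < length \<phi> \<and> j \<in> clause_vars (\<phi> ! i)}
      \<subseteq> questions1 (clause_variable_game N \<phi>) \<times> questions2 (clause_variable_game N \<phi>)"
    using c(2) by (auto simp: clause_variable_game_def)
qed (use assms in \<open>auto simp: clause_variable_game_def regular_3sat_def\<close>)

theorem theorem26:
  fixes d :: nat
  shows "\<exists>C::real. \<forall>(N::nat) (\<phi>::clause list) (k::nat) (l::nat).
           regular_3sat d N \<phi> \<longrightarrow> k \<in> {1..length \<phi>} \<longrightarrow> l \<in> {1..N} \<longrightarrow>
           game_value (clause_variable_game N \<phi>) \<ge>
             game_value (birthday_repetition (clause_variable_game N \<phi>) k l)
               - C * sqrt (real N / (real k * real l))"
proof (intro exI allI impI)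
  fix N \<phi> k l
  assume \<phi>: "regular_3sat d N \<phi>" and k: "k \<in> {1..length \<phi>}" and l: "l \<in> {1..N}"
  then have ne: "\<phi> \<noteq> []"
    by auto
  have "questions2 (clause_variable_game N \<phi>) = {..<N}"
    by (simp add: clause_variable_game_def)
  \<comment> \<open>The constant is \<open>sqrt ((1 + d\<^sub>1 + d\<^sub>2) / d\<^sub>1)\<close>
    for degrees 3 and \<open>d\<close>.\<close>
  then show "game_value (birthday_repetition (clause_variable_game N \<phi>) k l)
      - sqrt ((4 + real d) / 3) * sqrt (real N / (real k * real l))
      \<le> game_value (clause_variable_game N \<phi>)"
    using birthday_repetition_value[OF two_prover_game_clause_variable_game[OF \<phi> ne]
        question_dist_clause_variable_game[OF \<phi> ne] biregular_clause_variable_game[OF \<phi> k l]]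
    by (simp flip: real_sqrt_mult)
qed

end
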